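(* Let $X \subseteq \mathbb{Z}^d$ be a finite lattice-convex set of dimension $\dim(X) \geq 4$. Then \[ \operatorname{rc}(X) > \log_2 (\dim(X)) - \log_2 \log_2 (\dim(X)). \]
   Context: A set $X \subseteq \mathbb{Z}^d$ is lattice-convex if $\operatorname{conv}(X) \cap \mathbb{Z}^d = X$. The dimension $\dim(X)$ is the dimension of the affine hull of $X$. We say $X$ is described by $k$ linear inequalities within $\mathbb{Z}^d$ if $X = \{x \in \mathbb{Z}^d : Ax \le b,\ Ux = v\}$ for some real matrices $A, U$ and real vectors $b, v$, where $Ax \le b$ consists of $k$ inequalities (the number of equations $Ux=v$ is arbitrary and not counted). The relaxation complexity $\operatorname{rc}(X)$ is the minimal $k$ such that $X$ can be described by $k$ linear inequalities within $\mathbb{Z}^d$. *)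

theory Defs
  imports "HOL-Analysis.Analysis"
begin

text \<open>The lattice \<open>\<int>\<^sup>d\<close> is viewed inside \<open>\<real>\<^sup>d\<close>, with \<open>d = CARD('d)\<close>.\<close>

definition int_lattice :: "(real ^ 'd) set" where
  "int_lattice = {x. \<forall>i. x $ i \<in> \<int>}"

definition lattice_convex :: "(real ^ 'd) set \<Rightarrow> bool" where
  "lattice_convex X \<longleftrightarrow> convex hull X \<inter> int_lattice = X"

text \<open>The row numbers of \<open>A x \<le> b\<close> and \<open>U x = v\<close> vary (\<open>k\<close> is minimised over and \<open>m\<close> is
  arbitrary), so the matrices are given by their rows \<open>A i\<close> (\<open>i < k\<close>) and \<open>U j\<close> (\<open>j < m\<close>);
  values beyond these bounds are irrelevant.\<close>

definition described_by :: "(real ^ 'd) set \<Rightarrow> nat \<Rightarrow> bool" where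
  "described_by X k \<longleftrightarrow>
     (\<exists>(A :: nat \<Rightarrow> real ^ 'd) (b :: nat \<Rightarrow> real) (m :: nat) (U :: nat \<Rightarrow> real ^ 'd) (v :: nat \<Rightarrow> real).
        X = {x \<in> int_lattice. (\<forall>i<k. A i \<bullet> x \<le> b i) \<and> (\<forall>j<m. U j \<bullet> x = v j)})"

text \<open>The minimum exists whenever some description of \<open>X\<close> exists, in particular for every finite
  lattice-convex \<open>X\<close> (lemma \<open>finite_lattice_convex_described\<close> below); otherwise the value of
  \<open>rc X\<close> is unspecified.\<close>

definition rc :: "(real ^ 'd) set \<Rightarrow> nat" where
  "rc X = (LEAST k. described_by X k)"

lemma finite_lattice_convex_described:
  fixes X :: "(real ^ 'd) set"
  assumes "finite X" and "lattice_convex X"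
  shows "\<exists>k. described_by X k"
proof -
  have "polyhedron (convex hull X)"
    using assms(1) polytope_convex_hull polytope_imp_polyhedron by blast
  then obtain F where F: "finite F" "convex hull X = \<Inter>F"
    and "\<forall>h\<in>F. \<exists>a b. a \<noteq> 0 \<and> h = {x. a \<bullet> x \<le> b}"
    unfolding polyhedron_def by blast
  then obtain a b where ab: "\<And>h. h \<in> F \<Longrightarrow> h = {x. a h \<bullet> x \<le> b h}"
    by metis
  obtain hs where hs: "set hs = F"
    using F(1) finite_list by blast
  have "x \<in> convex hull X \<longleftrightarrow> (\<forall>i<length hs. a (hs ! i) \<bullet> x \<le> b (hs ! i))" for x
  proof -
    have "x \<in> convex hull X \<longleftrightarrow> (\<forall>h\<in>set hs. x \<in> h)"
      using F(2) hs by simp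
    also have "\<dots> \<longleftrightarrow> (\<forall>h\<in>set hs. a h \<bullet> x \<le> b h)"
      using ab hs by blast
    finally show ?thesis
      by (simp add: all_set_conv_all_nth)
  qed
  then have "X = {x \<in> int_lattice. (\<forall>i<length hs. a (hs ! i) \<bullet> x \<le> b (hs ! i)) \<and>
                 (\<forall>j<(0::nat). (0 :: real ^ 'd) \<bullet> x = 0)}"
    using assms(2) unfolding lattice_convex_def by auto
  then show ?thesis
    unfolding described_by_def
    by (intro exI[of _ "length hs"] exI[of _ "\<lambda>i. a (hs ! i)"] exI[of _ "\<lambda>i. b (hs ! i)"]
        exI[of _ 0] exI[of _ "\<lambda>_. 0"]) auto
qed

end

theory Submission
  imports Defs
begin

text \<open>Fix a description of \<open>X\<close> by \<open>k\<close> inequalities and group the points of \<open>X\<close> by the set of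
  inequalities that they satisfy with equality. If such a class had dimension greater than \<open>k\<close>,
  then some nonzero vector \<open>u\<close> in the span of its differences would be orthogonal to all rows \<open>A i\<close>.
  Simultaneous Diophantine approximation gives an integral combination \<open>z\<close> of the differences
  arbitrarily close to a positive multiple of \<open>u\<close>. Translating a point of the class by \<open>z\<close> preserves
  the equations and the tight inequalities exactly, and the slack ones because \<open>A i \<bullet> z\<close> is tiny;
  as \<open>u\<close> can be taken longer than the diameter of \<open>X\<close>, this contradicts finiteness.
  So \<open>X\<close> consists of at most \<open>2 ^ k\<close> classes, each containing at most \<open>k + 1\<close> affinely independent
  points, whence \<open>dim X < 2 ^ k * (k + 1)\<close>.\<close>

text \<open>Dirichlet's theorem rounds all coefficients of \<open>q * u\<close> to integers at once,
  each with error at most \<open>1 / N\<close>, so the total error is at most the sum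
  \<open>M\<close> of the norms over \<open>N\<close>.\<close>

lemma span_integer_combination_approx:
  fixes u :: "'a::real_normed_vector"
  assumes "finite D" and "u \<in> span D" and "e > 0"
  obtains c :: "'a \<Rightarrow> int" and q :: int
  where "q > 0" and "norm ((\<Sum>w\<in>D. of_int (c w) *\<^sub>R w) - of_int q *\<^sub>R u) < e"
proof -
  obtain t where t: "u = (\<Sum>w\<in>D. t w *\<^sub>R w)"
    using assms(1,2) by (auto simp: span_finite)
  obtain f n where f: "bij_betw f D {..<n::nat}"
    using ex_bij_betw_finite_nat[OF assms(1)] by (auto simp: atLeast0LessThan)
  define M where "M = (\<Sum>w\<in>D. norm w)"
  obtain N :: nat where "real N > max (M / e) 0"
    using reals_Archimedean2 by blast
  then have N: "real N > M / e" "N > 0"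
    by auto
  obtain q p where q: "q > 0"
    and p: "\<And>i. i < n \<Longrightarrow> \<bar>of_int q * t (inv_into D f i) - of_int (p i)\<bar> < 1 / N"
    using Dirichlet_approx_simult[OF N(2), where n = n and \<theta> = "\<lambda>i. t (inv_into D f i)"] by metis
  have c: "\<bar>of_int (p (f w)) - of_int q * t w\<bar> \<le> 1 / N" if "w \<in> D" for w
    using p[of "f w"] that f by (fastforce simp: bij_betw_def abs_minus_commute)
  have "norm ((\<Sum>w\<in>D. of_int (p (f w)) *\<^sub>R w) - of_int q *\<^sub>R u)
      = norm (\<Sum>w\<in>D. (of_int (p (f w)) - of_int q * t w) *\<^sub>R w)"
    by (simp add: t scaleR_sum_right sum_subtractf scaleR_left_diff_distrib)
  also have "\<dots> \<le> (\<Sum>w\<in>D. (1 / N) * norm w)"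
    by (rule sum_norm_le) (use c in \<open>auto intro!: mult_right_mono simp del: times_divide_eq_left\<close>)
  also have "\<dots> = M / N"
    by (simp add: M_def sum_divide_distrib)
  also have "\<dots> < e"
    using N assms(3) by (simp add: field_simps)
  finally show thesis
    using q by (intro that[of q "p \<circ> f"]) auto
qed

text \<open>Dimension count: the orthogonal complement \<open>K\<close> of \<open>k\<close> rows has
  codimension at most \<open>k\<close>, so it meets \<open>span D\<close> nontrivially.\<close>

lemma exists_span_orthogonal_to_rows:
  fixes A :: "nat \<Rightarrow> 'a::euclidean_space"
  assumes "dim D > k"
  obtains u where "u \<in> span D" and "u \<noteq> 0" and "\<And>i. i < k \<Longrightarrow> A i \<bullet> u = 0"
proof -
  define R where "R = span (A ` {..<k})"
  define K where "K = {y \<in> UNIV. \<forall>x\<in>R. orthogonal x y}"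
  have K: "dim K + dim R = DIM('a)"
    unfolding K_def using dim_subspace_orthogonal_to_vectors[of R UNIV] by (simp add: R_def)
  have "dim R \<le> k"
    unfolding R_def dim_span using dim_le_card'[of "A ` {..<k}"] card_image_le[of "{..<k}" A] by simp
  moreover have "subspace K"
    unfolding K_def using subspace_orthogonal_to_vectors by auto
  then have "dim {x + y |x y. x \<in> span D \<and> y \<in> K} + dim (span D \<inter> K) = dim (span D) + dim K"
    by (intro dim_sums_Int) auto
  moreover have "dim {x + y |x y. x \<in> span D \<and> y \<in> K} \<le> DIM('a)"
    by (rule dim_subset_UNIV)
  ultimately have "dim (span D \<inter> K) > 0"
    using assms K by (simp add: dim_span)
  then obtain u where "u \<in> span D" "u \<in> K" "u \<noteq> 0"
    by (metis IntE dim_eq_0 singletonI subsetI less_irrefl)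
  moreover from this have "A i \<bullet> u = 0" if "i < k" for i
    using that unfolding K_def R_def orthogonal_def by (auto intro: span_base)
  ultimately show thesis
    using that by blast
qed

text \<open>Stated for any subset \<open>F\<close> of a tightness class, so that it applies to the
  part of an affine basis lying in one class.\<close>

lemma aff_dim_tight_class_le:
  fixes A U :: "nat \<Rightarrow> real ^ 'd"
  assumes X: "X = {x \<in> int_lattice. (\<forall>i<k. A i \<bullet> x \<le> b i) \<and> (\<forall>j<m. U j \<bullet> x = v j)}"
    and "finite X" and "F \<subseteq> X"
    and tight: "\<And>x y i. \<lbrakk>x \<in> F; y \<in> F; i < k; A i \<bullet> x = b i\<rbrakk> \<Longrightarrow> A i \<bullet> y = b i"
  shows "aff_dim F \<le> int k"
proof (rule ccontr)
  assume big: "\<not> aff_dim F \<le> int k"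
  then obtain x0 where x0: "x0 \<in> F"
    by fastforce
  define D where "D = (+) (- x0) ` F"
  have "dim D > k"
    using big aff_dim_eq_dim[of x0 F] x0 by (simp add: D_def hull_inc)
  then obtain u' where u': "u' \<in> span D" "u' \<noteq> 0" "\<And>i. i < k \<Longrightarrow> A i \<bullet> u' = 0"
    using exists_span_orthogonal_to_rows[where A = A] by metis
  obtain R where R: "\<And>x. x \<in> X \<Longrightarrow> norm x \<le> R" "R > 0"
    using \<open>finite X\<close> finite_imp_bounded bounded_pos by metis
  \<comment> \<open>Two points of \<open>X\<close> differ by at most \<open>2 * R\<close>; the extra
    1 absorbs the approximation error \<open>e \<le> 1\<close>.\<close>
  define u where "u = ((2 * R + 1) / norm u') *\<^sub>R u'"
  have u: "u \<in> span D" "norm u = 2 * R + 1" "\<And>i. i < k \<Longrightarrow> A i \<bullet> u = 0"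
    using u' R(2) by (auto simp: u_def span_scale)
  define S where "S = {i. i < k \<and> A i \<bullet> x0 < b i}"
  \<comment> \<open>Small enough to preserve every slack inequality. The inserted 1 gives
    \<open>e \<le> 1\<close> and keeps the set nonempty if \<open>S\<close> is empty; the
    \<open>+ 1\<close> in the denominator covers zero rows.\<close>
  define e where "e = Min (insert 1 ((\<lambda>i. (b i - A i \<bullet> x0) / (norm (A i) + 1)) ` S))"
  have "finite S"
    by (simp add: S_def)
  then have e: "e > 0" "e \<le> 1" "\<And>i. i \<in> S \<Longrightarrow> e \<le> (b i - A i \<bullet> x0) / (norm (A i) + 1)"
    by (auto simp: e_def S_def intro!: divide_pos_pos add_nonneg_pos Min_le)
  have "finite D"
    using assms(2,3) finite_subset by (auto simp: D_def)
  then obtain c q where q: "q > 0"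
    and close: "norm ((\<Sum>w\<in>D. of_int (c w) *\<^sub>R w) - of_int q *\<^sub>R u) < e"
    using span_integer_combination_approx[OF _ u(1) e(1)] by metis
  define z where "z = (\<Sum>w\<in>D. of_int (c w) *\<^sub>R w)"
  \<comment> \<open>Although \<open>z\<close> only approximates a multiple of \<open>u\<close>, it
    is an exact combination of \<open>D\<close>, so equations and tight inequalities are preserved
    without error.\<close>
  have D_rows: "a \<bullet> z = 0" if "\<And>w. w \<in> D \<Longrightarrow> a \<bullet> w = 0" for a
    using that by (simp add: z_def inner_sum_right)
  have "w $ i \<in> \<int>" if "w \<in> D" for w i
    using that subsetD[OF assms(3)] x0 by (auto simp: D_def X int_lattice_def intro!: Ints_diff)
  then have "z \<in> int_lattice"
    by (auto simp: z_def int_lattice_def intro!: Ints_sum Ints_mult)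
  then have "x0 + z \<in> int_lattice"
    using assms(3) x0 by (auto simp: int_lattice_def X)
  moreover have "U j \<bullet> (x0 + z) = v j" if "j < m" for j
  proof -
    have row: "U j \<bullet> x = v j" if "x \<in> F" for x
      using subsetD[OF assms(3) that] \<open>j < m\<close> by (simp add: X)
    then have "U j \<bullet> z = 0"
      using x0 by (intro D_rows) (auto simp: D_def inner_diff_right)
    then show ?thesis
      using row[OF x0] by (simp add: inner_add_right)
  qed
  moreover have "A i \<bullet> (x0 + z) \<le> b i" if "i < k" for i
  proof (cases "A i \<bullet> x0 = b i")
    case True
    then have "A i \<bullet> z = 0"
      using tight[OF x0 _ that True] by (intro D_rows) (auto simp: D_def inner_diff_right)
    then show ?thesis
      using True by (simp add: inner_add_right)
  next
    case False
    then have i: "i \<in> S"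
      using assms(3) x0 that by (fastforce simp: S_def X)
    \<comment> \<open>As \<open>A i\<close> is orthogonal to \<open>u\<close>, only the
      approximation error contributes.\<close>
    have "A i \<bullet> z = A i \<bullet> (z - of_int q *\<^sub>R u)"
      using u(3)[OF that] by (simp add: inner_diff_right)
    also have "\<dots> \<le> norm (A i) * norm (z - of_int q *\<^sub>R u)"
      by (rule norm_cauchy_schwarz)
    also have "\<dots> \<le> (norm (A i) + 1) * e"
      using close e(1) by (intro mult_mono) (auto simp: z_def)
    also have "\<dots> \<le> b i - A i \<bullet> x0"
      using e(3)[OF i] norm_ge_zero[of "A i"]
      by (subst (asm) pos_le_divide_eq) (auto simp: mult.commute intro: add_nonneg_pos)
    finally show ?thesis
      by (simp add: inner_add_right)
  qed
  ultimately have "x0 + z \<in> X"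
    by (simp add: X)
  moreover have "x0 \<in> X"
    using assms(3) x0 by blast
  ultimately have "norm z \<le> 2 * R"
    using R(1)[of "x0 + z"] R(1)[of x0] norm_triangle_ineq4[of "x0 + z" x0] by simp
  moreover have "norm u \<le> norm (of_int q *\<^sub>R u)"
    using q by (simp add: mult_le_cancel_right1)
  \<comment> \<open>Since \<open>q \<ge> 1\<close>,
    \<open>norm z > norm u - e \<ge> 2 * R\<close>.\<close>
  ultimately show False
    using norm_triangle_ineq3[of z "of_int q *\<^sub>R u"] close e(2) u(2) unfolding z_def by linarith
qed

text \<open>Counts an affine basis \<open>B\<close> of \<open>X\<close> class by class; the
  inequality is strict because \<open>B\<close> has \<open>aff_dim X + 1\<close> points.\<close>

lemma aff_dim_less_of_described_by:
  fixes X :: "(real ^ 'd) set"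
  assumes "finite X" and "described_by X k"
  shows "aff_dim X < 2 ^ k * (int k + 1)"
proof -
  obtain A b U v and m :: nat
    where X: "X = {x \<in> int_lattice. (\<forall>i<k. A i \<bullet> x \<le> b i) \<and> (\<forall>j<m. U j \<bullet> x = v j)}"
    using assms(2) unfolding described_by_def by blast
  obtain B where B: "B \<subseteq> X" "\<not> affine_dependent B" "affine hull X = affine hull B"
    using affine_basis_exists by blast
  have finB: "finite B" and cardB: "int (card B) = aff_dim X + 1"
    using B aff_independent_finite aff_dim_unique[of B X] by auto
  define F where "F I = {x \<in> B. {i. i < k \<and> A i \<bullet> x = b i} = I}" for I
  have F: "card (F I) \<le> k + 1" for I
  proof -
    have "aff_dim (F I) \<le> int k"
      using B(1) by (intro aff_dim_tight_class_le[OF X assms(1)]) (auto simp: F_def)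
    moreover have "\<not> affine_dependent (F I)"
      using B(2) by (rule affine_independent_subset) (auto simp: F_def)
    ultimately show ?thesis
      using aff_dim_affine_independent[of "F I"] by linarith
  qed
  have "B = (\<Union>I\<in>Pow {..<k}. F I)"
    by (auto simp: F_def)
  then have "card B \<le> (\<Sum>I\<in>Pow {..<k}. card (F I))"
    by (metis card_UN_le finite_Pow_iff finite_lessThan)
  also have "\<dots> \<le> 2 ^ k * (k + 1)"
    using sum_bounded_above[of "Pow {..<k}" "\<lambda>I. card (F I)" "k + 1"] F by (simp add: card_Pow)
  finally have "int (card B) \<le> int (2 ^ k * (k + 1))"
    by (rule of_nat_mono)
  then show ?thesis
    using cardB by (simp add: algebra_simps)
qed

text \<open>From \<open>n \<ge> 4\<close> the iterated logarithm is at least 1. If the claim failed,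
  then \<open>k + 1 \<le> log 2 n\<close>, and hence
  \<open>2 ^ k * (k + 1) \<le> 2 ^ k * log 2 n \<le> n\<close>.\<close>

lemma log_minus_log_log_less:
  fixes n :: real and k :: nat
  assumes "n \<ge> 4" and "n < 2 ^ k * (real k + 1)"
  shows "log 2 n - log 2 (log 2 n) < k"
proof (rule ccontr)
  assume "\<not> ?thesis"
  then have k: "real k + log 2 (log 2 n) \<le> log 2 n"
    by simp
  have "log 2 4 \<le> log 2 n"
    using assms(1) by simp
  moreover have "log 2 4 = (2::real)"
    using log_pow_cancel[of 2 2] by simp
  ultimately have l: "log 2 n \<ge> 2"
    by simp
  then have "log 2 (log 2 n) \<ge> 1"
    using one_le_log_cancel_iff by simp
  then have "real k + 1 \<le> log 2 n"
    using k by simp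
  then have "2 ^ k * (real k + 1) \<le> 2 ^ k * log 2 n"
    by simp
  also have "\<dots> = 2 powr (real k + log 2 (log 2 n))"
    using l by (simp add: powr_add powr_realpow)
  also have "\<dots> \<le> 2 powr (log 2 n)"
    using k by simp
  also have "\<dots> = n"
    using assms(1) by simp
  finally show False
    using assms(2) by simp
qed

theorem theorem1p2:
  fixes X :: "(real ^ 'd) set"
  assumes "X \<subseteq> int_lattice"
    and "finite X"
    and "lattice_convex X"
    and "aff_dim X \<ge> 4"
  shows "real (rc X) > log 2 (real_of_int (aff_dim X)) - log 2 (log 2 (real_of_int (aff_dim X)))"
proof (rule log_minus_log_log_less)
  \<comment> \<open>Finiteness and lattice-convexity provide some description, so the
    \<open>LEAST\<close> in \<open>rc\<close> is attained.\<close>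
  have "described_by X (rc X)"
    unfolding rc_def by (rule LeastI_ex) (rule finite_lattice_convex_described[OF assms(2,3)])
  then have "aff_dim X < 2 ^ rc X * (int (rc X) + 1)"
    by (rule aff_dim_less_of_described_by[OF assms(2)])
  then have "real_of_int (aff_dim X) < real_of_int (2 ^ rc X * (int (rc X) + 1))"
    by (simp only: of_int_less_iff)
  then show "real_of_int (aff_dim X) < 2 ^ rc X * (real (rc X) + 1)"
    by simp
qed (use assms(4) in simp)

end
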